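(* (1) Let $B$ be a finite subset of $\mathrm{R}_1$. Then every temporal $B$-formula over $\{\mathsf{F},\mathsf{G},\mathsf{X},\mathsf{U},\mathsf{S}\}$ is satisfiable. (2) Let $B$ be a finite subset of $\mathrm{D}$. Then every temporal $B$-formula over $\{\mathsf{F},\mathsf{G},\mathsf{X},\mathsf{U},\mathsf{S}\}$ is satisfiable.
   Context: A Boolean function is a map $f:\{0,1\}^n\to\{0,1\}$; each is used as an $n$-ary propositional connective. $\mathrm{R}_1$ is the set of 1-reproducing Boolean functions ($f(1,\dots,1)=1$). $\mathrm{D}$ is the set of self-dual Boolean functions ($f(x_1,\dots,x_n)=\neg f(\neg x_1,\dots,\neg x_n)$ for all arguments). A temporal $B$-formula over a set $M$ of temporal operators is built from propositional variables using connectives from $B$ and operators from $M$. A structure $S=(s,V,\xi)$ is an infinite sequence $(s_i)_{i\in\mathbb N}$ of distinct states, a variable set $V$, and $\xi$ assigning to each state the set of variables true there. Semantics: $S,s_i\models x$ iff $x\in\xi(s_i)$; Boolean connectives pointwise; $S,s_i\models\mathsf{X}\varphi$ iff $S,s_{i+1}\models\varphi$; $S,s_i\models\varphi_1\mathsf{U}\varphi_2$ iff some $k\ge i$ has $S,s_k\models\varphi_2$ and $S,s_j\models\varphi_1$ for all $i\le j<k$; $S,s_i\models\varphi_1\mathsf{S}\varphi_2$ iff some $k\le i$ has $S,s_k\models\varphi_2$ and $S,s_j\models\varphi_1$ for all $k<j\le i$; $\mathsf{F}\varphi=\mathrm{true}\,\mathsf{U}\,\varphi$, $\mathsf{G}\varphi=\neg\mathsf{F}\neg\varphi$.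 A formula is satisfiable if it holds at some state of some structure. *)

theory Defs
  imports Main "HOL-Library.FuncSet"
begin

text \<open>
  A Boolean function is given by its arity \<open>n\<close> and a map on the argument lists of length \<open>n\<close>.
  Requiring the map to be \<^const>\<open>undefined\<close> elsewhere makes the representation unique.
\<close>

type_synonym boolean_function = "nat \<times> (bool list \<Rightarrow> bool)"

definition boolean_functions :: "boolean_function set" where
  "boolean_functions = {(n, f). f \<in> {xs. length xs = n} \<rightarrow>\<^sub>E UNIV}"

definition R1 :: "boolean_function set" where
  "R1 = {(n, f) \<in> boolean_functions. f (replicate n True) = True}"

definition D :: "boolean_function set" where
  "D = {(n, f) \<in> boolean_functions. \<forall>xs. length xs = n \<longrightarrow> f xs = (\<not> f (map Not xs))}"

datatype temporal_operator = OpF | OpG | OpX | OpU | OpS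

datatype 'v formula =
    Var 'v
  | Conn boolean_function "'v formula list"
  | Future "'v formula"
  | Globally "'v formula"
  | Next "'v formula"
  | Until "'v formula" "'v formula"
  | Since "'v formula" "'v formula"

inductive temporal_formula ::
  "boolean_function set \<Rightarrow> temporal_operator set \<Rightarrow> 'v formula \<Rightarrow> bool"
  for B :: "boolean_function set" and M :: "temporal_operator set" where
  "temporal_formula B M (Var x)"
| "(n, f) \<in> B \<Longrightarrow> length \<phi>s = n \<Longrightarrow> \<forall>\<phi>\<in>set \<phi>s. temporal_formula B M \<phi> \<Longrightarrow>
     temporal_formula B M (Conn (n, f) \<phi>s)"
| "OpF \<in> M \<Longrightarrow> temporal_formula B M \<phi> \<Longrightarrow> temporal_formula B M (Future \<phi>)"
| "OpG \<in> M \<Longrightarrow> temporal_formula B M \<phi> \<Longrightarrow> temporal_formula B M (Globally \<phi>)"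
| "OpX \<in> M \<Longrightarrow> temporal_formula B M \<phi> \<Longrightarrow> temporal_formula B M (Next \<phi>)"
| "OpU \<in> M \<Longrightarrow> temporal_formula B M \<phi> \<Longrightarrow> temporal_formula B M \<psi> \<Longrightarrow>
     temporal_formula B M (Until \<phi> \<psi>)"
| "OpS \<in> M \<Longrightarrow> temporal_formula B M \<phi> \<Longrightarrow> temporal_formula B M \<psi> \<Longrightarrow>
     temporal_formula B M (Since \<phi> \<psi>)"

record ('s, 'v) struct =
  states :: "nat \<Rightarrow> 's"
  vars :: "'v set"
  val :: "'s \<Rightarrow> 'v set"

definition is_structure :: "('s, 'v) struct \<Rightarrow> bool" where
  "is_structure S \<longleftrightarrow> inj (states S) \<and> (\<forall>i. val S (states S i) \<subseteq> vars S)"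

definition holds_until :: "(nat \<Rightarrow> bool) \<Rightarrow> (nat \<Rightarrow> bool) \<Rightarrow> nat \<Rightarrow> bool" where
  "holds_until P Q i \<longleftrightarrow> (\<exists>k\<ge>i. Q k \<and> (\<forall>j. i \<le> j \<and> j < k \<longrightarrow> P j))"

definition holds_since :: "(nat \<Rightarrow> bool) \<Rightarrow> (nat \<Rightarrow> bool) \<Rightarrow> nat \<Rightarrow> bool" where
  "holds_since P Q i \<longleftrightarrow> (\<exists>k\<le>i. Q k \<and> (\<forall>j. k < j \<and> j \<le> i \<longrightarrow> P j))"

text \<open>
  States of a structure are pairwise distinct, so they are referred to by their index.
  The clauses for \<^const>\<open>Future\<close> and \<^const>\<open>Globally\<close> unfold
  \<open>F \<phi> = true U \<phi>\<close> and \<open>G \<phi> = \<not> F \<not> \<phi>\<close> semantically, since \<open>true\<close> and \<open>\<not>\<close> need not be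
  available as connectives.
\<close>

fun sat :: "('s, 'v) struct \<Rightarrow> nat \<Rightarrow> 'v formula \<Rightarrow> bool" where
  "sat S i (Var x) \<longleftrightarrow> x \<in> val S (states S i)"
| "sat S i (Conn (n, f) \<phi>s) \<longleftrightarrow> f (map (\<lambda>\<phi>. sat S i \<phi>) \<phi>s)"
| "sat S i (Future \<phi>) \<longleftrightarrow> holds_until (\<lambda>j. True) (\<lambda>j. sat S j \<phi>) i"
| "sat S i (Globally \<phi>) \<longleftrightarrow> \<not> holds_until (\<lambda>j. True) (\<lambda>j. \<not> sat S j \<phi>) i"
| "sat S i (Next \<phi>) \<longleftrightarrow> sat S (Suc i) \<phi>"
| "sat S i (Until \<phi> \<psi>) \<longleftrightarrow> holds_until (\<lambda>j. sat S j \<phi>) (\<lambda>j. sat S j \<psi>) i"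
| "sat S i (Since \<phi> \<psi>) \<longleftrightarrow> holds_since (\<lambda>j. sat S j \<phi>) (\<lambda>j. sat S j \<psi>) i"

text \<open>
  Satisfaction in a structure concerns formulas whose variables (\<^const>\<open>set_formula\<close>) belong to its
  variable set. Structures with states in \<^typ>\<open>nat\<close> suffice, because a sequence of distinct states
  can be renamed along its indices.
\<close>

definition satisfiable :: "'v formula \<Rightarrow> bool" where
  "satisfiable \<phi> \<longleftrightarrow>
     (\<exists>(S :: (nat, 'v) struct) i. is_structure S \<and> set_formula \<phi> \<subseteq> vars S \<and> sat S i \<phi>)"

end

theory Submission
  imports Defs
begin

text \<open>
  In a structure whose valuation is the same at every state, the truth value of a formula does not
  depend on the state. Hence \<open>F\<close>, \<open>G\<close> and \<open>X\<close> act as the identity, and \<open>\<phi> U \<psi>\<close> and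
  \<open>\<phi> S \<psi>\<close> are equivalent to \<open>\<psi>\<close>, so that a formula behaves like a propositional one. For
  1-reproducing connectives, making all variables true everywhere makes every formula true. For
  self-dual connectives, complementing the valuation negates every formula, so each formula holds
  under a given valuation or under its complement.
\<close>

text \<open>The choice \<open>vars = UNIV\<close> makes the variable condition of
  \<open>satisfiable\<close> trivial, and \<open>id\<close> makes the states distinct.\<close>

definition constant_struct :: "'v set \<Rightarrow> (nat, 'v) struct" where
  "constant_struct A = \<lparr>states = id, vars = UNIV, val = (\<lambda>_. A)\<rparr>"

lemma satisfiable_if_sat_constant_struct:
  "sat (constant_struct A) i \<phi> \<Longrightarrow> satisfiable \<phi>"
  unfolding satisfiable_def is_structure_def
  by (rule exI[of _ "constant_struct A"]) (auto simp: constant_struct_def)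

text \<open>The witness \<open>k = i\<close> leaves no index at which \<open>P\<close> is required,
  so \<open>P\<close> is arbitrary.\<close>

lemma holds_until_const:
  assumes "\<And>j. Q j \<longleftrightarrow> q"
  shows "holds_until P Q i \<longleftrightarrow> q"
  unfolding holds_until_def assms by auto

lemma holds_since_const:
  assumes "\<And>j. Q j \<longleftrightarrow> q"
  shows "holds_since P Q i \<longleftrightarrow> q"
  unfolding holds_since_def assms by auto

lemma sat_temporal_if_state_independent:
  assumes "\<And>j. sat S j \<phi> \<longleftrightarrow> q"
  shows "sat S i (Future \<phi>) \<longleftrightarrow> q"
    and "sat S i (Globally \<phi>) \<longleftrightarrow> q"
    and "sat S i (Next \<phi>) \<longleftrightarrow> q"
    and "sat S i (Until \<psi> \<phi>) \<longleftrightarrow> q"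
    and "sat S i (Since \<psi> \<phi>) \<longleftrightarrow> q"
  \<comment> \<open>The instance with \<open>\<not> q\<close> serves \<open>Globally\<close>, whose
    definition negates its argument.\<close>
  by (simp_all add: assms holds_until_const[of _ q] holds_until_const[of _ "\<not> q"]
      holds_since_const[of _ q])

lemma sat_constant_struct_state_independent:
  "sat (constant_struct A) i \<phi> \<longleftrightarrow> sat (constant_struct A) j \<phi>"
proof (induction \<phi> arbitrary: i j)
  case (Var x)
  show ?case by (simp add: constant_struct_def)
next
  case (Conn g \<phi>s)
  obtain n f where "g = (n, f)" by fastforce
  moreover have "map (sat (constant_struct A) i) \<phi>s = map (sat (constant_struct A) j) \<phi>s"
    by (intro map_cong refl) (rule Conn)
  ultimately show ?case by (simp only: sat.simps)
next
  case (Future \<phi>)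
  \<comment> \<open>Here \<open>q\<close> becomes the value of \<open>\<phi>\<close> at a free
    state, so two instances of \<open>*\<close> sharing that state can be chained.\<close>
  note * = sat_temporal_if_state_independent(1)[OF Future]
  show ?case by (rule trans[OF * *[symmetric]])
next
  case (Globally \<phi>)
  note * = sat_temporal_if_state_independent(2)[OF Globally]
  show ?case by (rule trans[OF * *[symmetric]])
next
  case (Next \<phi>)
  note * = sat_temporal_if_state_independent(3)[OF Next]
  show ?case by (rule trans[OF * *[symmetric]])
next
  case (Until \<psi> \<phi>)
  note * = sat_temporal_if_state_independent(4)[OF Until(2)]
  show ?case by (rule trans[OF * *[symmetric]])
next
  case (Since \<psi> \<phi>)
  note * = sat_temporal_if_state_independent(5)[OF Since(2)]
  show ?case by (rule trans[OF * *[symmetric]])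
qed

lemma sat_constant_struct_temporal:
  fixes A :: "'v set"
  defines "S \<equiv> constant_struct A"
  shows "sat S i (Future \<phi>) \<longleftrightarrow> sat S i \<phi>"
    and "sat S i (Globally \<phi>) \<longleftrightarrow> sat S i \<phi>"
    and "sat S i (Next \<phi>) \<longleftrightarrow> sat S i \<phi>"
    and "sat S i (Until \<psi> \<phi>) \<longleftrightarrow> sat S i \<phi>"
    and "sat S i (Since \<psi> \<phi>) \<longleftrightarrow> sat S i \<phi>"
  unfolding S_def
  by (rule sat_temporal_if_state_independent[OF sat_constant_struct_state_independent])+

lemma sat_constant_struct_UNIV:
  assumes "temporal_formula B M \<phi>" and "B \<subseteq> R1"
  shows "sat (constant_struct UNIV) i \<phi>"
  using assms(1)
proof induction
  case (1 x)
  then show ?case by (simp add: constant_struct_def)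
next
  case (2 n f \<phi>s)
  then have "map (sat (constant_struct UNIV) i) \<phi>s = replicate n True"
    by (intro replicate_eqI) auto
  moreover have "f (replicate n True)"
    using 2 assms(2) by (auto simp: R1_def)
  ultimately show ?case by simp
\<comment> \<open>Every temporal operator reduces to a subformula at the same state, so the
  induction can keep \<open>i\<close> fixed.\<close>
qed (simp_all only: sat_constant_struct_temporal)

lemma sat_constant_struct_Compl:
  assumes "temporal_formula B M \<phi>" and "B \<subseteq> D"
  shows "sat (constant_struct (- A)) i \<phi> \<longleftrightarrow> \<not> sat (constant_struct A) i \<phi>"
  using assms(1)
proof induction
  case (1 x)
  then show ?case by (simp add: constant_struct_def)
next
  case (2 n f \<phi>s)
  then have *: "map (sat (constant_struct (- A)) i) \<phi>s = map Not (map (sat (constant_struct A) i) \<phi>s)"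
    by simp
  have "f xs \<longleftrightarrow> \<not> f (map Not xs)" if "length xs = n" for xs
    using 2 assms(2) that unfolding D_def by blast
  from this[of "map (sat (constant_struct A) i) \<phi>s"]
  have "f (map (sat (constant_struct A) i) \<phi>s) \<longleftrightarrow>
      \<not> f (map Not (map (sat (constant_struct A) i) \<phi>s))"
    using 2 by (simp only: length_map)
  then show ?case
    unfolding sat.simps * by blast
qed (simp_all only: sat_constant_struct_temporal)

theorem theorem3p5:
  "(\<forall>B. finite B \<and> B \<subseteq> R1 \<longrightarrow>
      (\<forall>\<phi> :: 'v formula. temporal_formula B {OpF, OpG, OpX, OpU, OpS} \<phi> \<longrightarrow> satisfiable \<phi>)) \<and>
   (\<forall>B. finite B \<and> B \<subseteq> D \<longrightarrow>
      (\<forall>\<phi> :: 'v formula. temporal_formula B {OpF, OpG, OpX, OpU, OpS} \<phi> \<longrightarrow> satisfiable \<phi>))"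
proof (intro conjI allI impI; elim conjE)
  fix B and \<phi> :: "'v formula"
  assume "B \<subseteq> R1" and "temporal_formula B {OpF, OpG, OpX, OpU, OpS} \<phi>"
  then show "satisfiable \<phi>"
    by (blast intro: satisfiable_if_sat_constant_struct sat_constant_struct_UNIV)
next
  fix B and \<phi> :: "'v formula"
  assume "B \<subseteq> D" and "temporal_formula B {OpF, OpG, OpX, OpU, OpS} \<phi>"
  \<comment> \<open>Any set and its complement would do; these are the all-true and all-false
    valuations.\<close>
  then have "sat (constant_struct (- {})) 0 \<phi> \<or> sat (constant_struct {}) 0 \<phi>"
    using sat_constant_struct_Compl by blast
  then show "satisfiable \<phi>"
    by (blast intro: satisfiable_if_sat_constant_struct)
qed

end
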